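(* Let $p=2$, $f\equiv0$, and for $\lambda\in(-\varepsilon_0,\varepsilon_0)$ let $\Omega_\lambda=(1+\lambda)\Omega$ and let $c(\lambda)$ be the additive eigenvalue of $H(\xi)=|\xi|^2$ on $\Omega_\lambda$. Then the map $\lambda\mapsto c(\lambda)$ is twice differentiable everywhere.
   Context: $\varepsilon>0$ is fixed. $\Omega\subset\mathbb{R}^n$ is open, bounded, connected, with $C^2$ boundary, star-shaped with respect to the origin, and there is $\kappa>0$ such that $\overline{B(0,\kappa)}\subset\Omega$ and $\mathrm{dist}(x,\overline\Omega)\ge\kappa s$ for all $x\in(1+s)\partial\Omega$ and all $s>0$. Here $\varepsilon_0\in(0,1)$. For $p=2$ and $f\equiv 0$, the additive eigenvalue $c(\lambda)$ is the unique constant for which the problem $$|Dv(x)|^2-\varepsilon\Delta v(x)=c(\lambda)\ \text{ in }\Omega_\lambda,\qquad v=+\infty\ \text{ on }\partial\Omega_\lambda$$ has a solution (solutions are unique up to an additive constant; the boundary condition means $v(x)\to+\infty$ as $x\to\partial\Omega_\lambda$). Via $w=e^{-v/\varepsilon}$, it is the principal eigenvalue of $-\varepsilon^2\Delta$ on $\Omega_\lambda$ with Dirichlet boundary condition: $$c(\lambda)=\min\Big\{\int_{\Omega_\lambda}\varepsilon^2|Du|^2\,dx:\ u\in H^1_0(\Omega_\lambda),\ \|u\|_{L^2(\Omega_\lambda)}=1\Big\}.$$ *)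

theory Defs
  imports "HOL-Analysis.Analysis"
begin

definition grad :: "('a::euclidean_space \<Rightarrow> real) \<Rightarrow> 'a \<Rightarrow> 'a" where
  "grad v x = (THE D. GDERIV v x :> D)"

text \<open>The trace of the Hessian, the Hessian being the derivative of the gradient field.\<close>

definition laplacian :: "('a::euclidean_space \<Rightarrow> real) \<Rightarrow> 'a \<Rightarrow> real" where
  "laplacian v x = (\<Sum>b\<in>Basis. frechet_derivative (grad v) (at x) b \<bullet> b)"

text \<open>Twice continuously differentiable; intended for open \<open>S\<close>.\<close>

definition C2_on :: "'a set \<Rightarrow> ('a::euclidean_space \<Rightarrow> real) \<Rightarrow> bool" where
  "C2_on S v \<longleftrightarrow>
     (\<forall>x\<in>S. v differentiable (at x)) \<and>
     (\<forall>x\<in>S. grad v differentiable (at x)) \<and>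
     (\<forall>b\<in>Basis. continuous_on S (\<lambda>x. frechet_derivative (grad v) (at x) b))"

text \<open>
  Near each boundary point the set is, after reorienting the axes, the region strictly above the
  graph of a \<open>C\<^sup>2\<close> function of \<open>n - 1\<close> variables.  The new last axis is the unit vector
  \<open>e\<close>, so the last coordinate of \<open>x\<close> is \<open>x \<bullet> e\<close> and the remaining ones are given by
  the orthogonal projection \<open>x - (x \<bullet> e) e\<close> to the hyperplane orthogonal to \<open>e\<close>.  A
  \<open>C\<^sup>2\<close> function on that hyperplane is the restriction of a \<open>C\<^sup>2\<close> function \<open>\<gamma>\<close> on the
  whole space (extend it constantly along \<open>e\<close>), and \<open>\<gamma>\<close> is only evaluated on the hyperplane.
\<close>

definition C2_boundary :: "'a::euclidean_space set \<Rightarrow> bool" where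
  "C2_boundary S \<longleftrightarrow>
     (\<forall>z\<in>frontier S. \<exists>r>0. \<exists>e \<gamma>. norm e = 1 \<and> C2_on UNIV \<gamma> \<and>
        S \<inter> ball z r = {x \<in> ball z r. x \<bullet> e > \<gamma> (x - (x \<bullet> e) *\<^sub>R e)})"

text \<open>
  Classical solutions of \<open>|Dv|\<^sup>2 - \<epsilon> \<Delta>v = c\<close> in \<open>U\<close> with \<open>v = +\<infinity>\<close> on the boundary.
  For bounded \<open>U\<close> the frontier is compact, so blow-up at each frontier point is the same as
  \<open>v x \<rightarrow> +\<infinity>\<close> as the distance of \<open>x\<close> to the frontier tends to \<open>0\<close>.
\<close>

definition blowup_solution ::
    "real \<Rightarrow> 'a::euclidean_space set \<Rightarrow> real \<Rightarrow> ('a \<Rightarrow> real) \<Rightarrow> bool" where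
  "blowup_solution \<epsilon> U c v \<longleftrightarrow>
     C2_on U v \<and>
     (\<forall>x\<in>U. (norm (grad v x))\<^sup>2 - \<epsilon> * laplacian v x = c) \<and>
     (\<forall>z\<in>frontier U. filterlim v at_top (at z within U))"

definition additive_eigenvalue :: "real \<Rightarrow> 'a::euclidean_space set \<Rightarrow> real" where
  "additive_eigenvalue \<epsilon> U = (THE c. \<exists>v. blowup_solution \<epsilon> U c v)"

end

theory Submission
  imports Defs
begin

text \<open>
  If \<open>v\<close> solves the problem on \<open>\<Omega>\<close> with constant \<open>c\<close>, then \<open>x \<mapsto> v (x / r)\<close> solves it on
  \<open>r \<Omega>\<close> with constant \<open>c / r\<^sup>2\<close>.  So the eigenvalue on \<open>(1 + \<lambda>) \<Omega>\<close> is
  \<open>c(0) / (1 + \<lambda>)\<^sup>2\<close>, provided that the constant on \<open>\<Omega>\<close> is unique.  For uniqueness, let \<open>v\<close>, \<open>w\<close>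
  be solutions with constants \<open>a\<close>, \<open>b\<close>.  For \<open>s > 0\<close>, star-shapedness makes
  \<open>v\<^sub>s(x) = v (x / (1 + s))\<close> bounded on the closure of \<open>\<Omega>\<close>, so \<open>v\<^sub>s - w\<close> has an interior
  maximum.  There the gradients agree and the Laplacians are ordered, whence
  \<open>a / (1 + s)\<^sup>2 \<ge> b\<close>; let \<open>s \<rightarrow> 0\<close> and exchange \<open>v\<close> and \<open>w\<close>.  Existence is not an issue: if
  there is no solution on \<open>\<Omega>\<close>, there is none on any dilate, and the description operator then
  returns the same value for all \<open>\<lambda>\<close>.
\<close>

section \<open>Gradient and Laplacian\<close>

lemma grad_eqI:
  assumes "GDERIV v x :> D"
  shows "grad v x = D"
  unfolding grad_def
proof (rule the_equality)
  show "GDERIV v x :> D"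
    by (rule assms)
  fix E assume "GDERIV v x :> E"
  with assms have "(\<lambda>h. h \<bullet> E) = (\<lambda>h. h \<bullet> D)"
    unfolding gderiv_def by (metis has_derivative_unique)
  then show "E = D"
    by (metis inner_commute vector_eq_ldot)
qed

lemma GDERIV_grad:
  fixes v :: "'a::euclidean_space \<Rightarrow> real"
  assumes "v differentiable (at x)"
  shows "GDERIV v x :> grad v x"
proof -
  obtain f where f: "(v has_derivative f) (at x)"
    using assms unfolding differentiable_def by blast
  have lin: "linear f"
    using f has_derivative_linear by blast
  \<comment> \<open>The Riesz vector of the functional \<open>f\<close>, assembled from its values
    on the orthonormal basis.\<close>
  define D where "D = (\<Sum>b\<in>Basis. f b *\<^sub>R b)"
  have "f = (\<lambda>h. h \<bullet> D)"
  proof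
    fix h
    have "f h = f (\<Sum>b\<in>Basis. (h \<bullet> b) *\<^sub>R b)"
      by (simp add: euclidean_representation)
    also have "\<dots> = (\<Sum>b\<in>Basis. (h \<bullet> b) * f b)"
      using lin by (simp add: linear_sum linear_cmul)
    also have "\<dots> = h \<bullet> D"
      by (simp add: D_def inner_sum_right mult.commute)
    finally show "f h = h \<bullet> D" .
  qed
  then have "GDERIV v x :> D"
    using f by (simp add: gderiv_def)
  then show ?thesis
    by (simp add: grad_eqI)
qed

text \<open>The first derivative vanishes at the maximum. If \<open>l\<close> were positive,
  \<open>h'\<close> would be positive just to the right of 0, and the mean value theorem would push
  \<open>h\<close> above \<open>h 0\<close>.\<close>

lemma second_derivative_nonpos_at_max:
  fixes h h' :: "real \<Rightarrow> real"
  assumes "d > 0"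
    and max: "\<And>t. \<bar>t\<bar> < d \<Longrightarrow> h t \<le> h 0"
    and der: "\<And>t. \<bar>t\<bar> < d \<Longrightarrow> DERIV h t :> h' t"
    and der2: "DERIV h' 0 :> l"
  shows "l \<le> 0"
proof (rule ccontr)
  assume "\<not> l \<le> 0"
  have h0: "h' 0 = 0"
    using DERIV_local_max[of h "h' 0" 0 d] der[of 0] \<open>d > 0\<close> max by simp
  obtain e where e: "e > 0" "\<And>t. 0 < t \<Longrightarrow> t < e \<Longrightarrow> h' 0 < h' t"
    using DERIV_pos_inc_right[OF der2] \<open>\<not> l \<le> 0\<close> by auto
  define t where "t = min d e / 2"
  have t: "0 < t" "t < d" "t < e"
    using \<open>d > 0\<close> \<open>e > 0\<close> by (auto simp: t_def min_def)
  obtain z where z: "0 < z" "z < t" "h t - h 0 = (t - 0) * h' z"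
    using MVT2[of 0 t h h'] t der by auto
  then have "h t - h 0 > 0"
    using e(2)[of z] h0 t by simp
  then show False
    using max[of t] t by simp
qed

text \<open>The second-order test, applied to \<open>u - v\<close> along each coordinate line
  through \<open>x\<close>, orders the diagonal entries of the two Hessians. The Laplacian is the
  sum of these entries.\<close>

lemma grad_and_laplacian_at_max:
  fixes u v :: "'a::euclidean_space \<Rightarrow> real"
  assumes "open U" "x \<in> U" "C2_on U u" "C2_on U v"
    and max: "\<And>y. y \<in> U \<Longrightarrow> u y - v y \<le> u x - v x"
  shows "grad u x = grad v x" and "laplacian u x \<le> laplacian v x"
proof -
  have gd: "GDERIV u y :> grad u y" "GDERIV v y :> grad v y" if "y \<in> U" for y
    using assms(3,4) that GDERIV_grad unfolding C2_on_def by blast+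
  have dif: "((\<lambda>y. u y - v y) has_derivative (\<lambda>h. h \<bullet> (grad u y - grad v y))) (at y)"
    if "y \<in> U" for y
    using GDERIV_diff[OF gd[OF that]] by (simp add: gderiv_def)
  have "(\<lambda>h. h \<bullet> (grad u x - grad v x)) = (\<lambda>h. 0)"
    using differential_zero_maxmin[OF \<open>x \<in> U\<close> \<open>open U\<close> dif[OF \<open>x \<in> U\<close>]] max by blast
  then have "(grad u x - grad v x) \<bullet> (grad u x - grad v x) = 0"
    by metis
  then show "grad u x = grad v x"
    by simp
  define Du Dv where "Du = frechet_derivative (grad u) (at x)"
    and "Dv = frechet_derivative (grad v) (at x)"
  have D: "(grad u has_derivative Du) (at x)" "(grad v has_derivative Dv) (at x)"
    using assms(2,3,4) frechet_derivative_works unfolding C2_on_def Du_def Dv_def by blast+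
  have "Du b \<bullet> b \<le> Dv b \<bullet> b" if "b \<in> Basis" for b
  proof -
    obtain d where d: "d > 0" "ball x d \<subseteq> U"
      using \<open>open U\<close> \<open>x \<in> U\<close> open_contains_ball by blast
    have inU: "x + t *\<^sub>R b \<in> U" if "\<bar>t\<bar> < d" for t
      using d(2) that \<open>b \<in> Basis\<close> by (auto simp: dist_norm subset_iff)
    have line: "((\<lambda>t. x + t *\<^sub>R b) has_derivative (\<lambda>t. t *\<^sub>R b)) (at t)" for t
      by (auto intro!: derivative_eq_intros)
    have "(\<lambda>t. u (x + t *\<^sub>R b) - v (x + t *\<^sub>R b)) t \<le> (\<lambda>t. u (x + t *\<^sub>R b) - v (x + t *\<^sub>R b)) 0"
      if "\<bar>t\<bar> < d" for t
      using max[OF inU[OF that]] by simp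
    moreover have "DERIV (\<lambda>t. u (x + t *\<^sub>R b) - v (x + t *\<^sub>R b)) t :>
        b \<bullet> (grad u (x + t *\<^sub>R b) - grad v (x + t *\<^sub>R b))" if "\<bar>t\<bar> < d" for t
      using has_derivative_compose[OF line dif[OF inU[OF that]]]
      by (simp add: has_field_derivative_def mult_commute_abs)
    moreover have "DERIV (\<lambda>t. b \<bullet> (grad u (x + t *\<^sub>R b) - grad v (x + t *\<^sub>R b))) 0 :>
        b \<bullet> (Du b - Dv b)"
    proof -
      \<comment> \<open>The base point is rewritten so that the chain rule along \<open>line\<close>
        applies at parameter 0.\<close>
      have D': "(grad u has_derivative Du) (at (x + 0 *\<^sub>R b))"
        "(grad v has_derivative Dv) (at (x + 0 *\<^sub>R b))"
        using D by simp_all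
      have "((\<lambda>t. b \<bullet> (grad u (x + t *\<^sub>R b) - grad v (x + t *\<^sub>R b))) has_derivative
          (\<lambda>t. b \<bullet> (Du (t *\<^sub>R b) - Dv (t *\<^sub>R b)))) (at 0)"
        by (intro has_derivative_inner_right has_derivative_diff
            has_derivative_compose[OF line] D')
      moreover have "Du (t *\<^sub>R b) = t *\<^sub>R Du b" "Dv (t *\<^sub>R b) = t *\<^sub>R Dv b" for t
        using D has_derivative_linear linear_cmul by blast+
      ultimately show ?thesis
        by (simp add: has_field_derivative_def mult_commute_abs
            flip: scaleR_diff_right)
    qed
    ultimately have "b \<bullet> (Du b - Dv b) \<le> 0"
      by (rule second_derivative_nonpos_at_max[OF d(1)])
    then show ?thesis
      by (simp add: inner_diff_right inner_commute)
  qed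
  then show "laplacian u x \<le> laplacian v x"
    unfolding laplacian_def Du_def[symmetric] Dv_def[symmetric] by (rule sum_mono)
qed

section \<open>Dilations\<close>

lemma GDERIV_dilation:
  fixes v :: "'a::euclidean_space \<Rightarrow> real"
  assumes "v differentiable (at (a *\<^sub>R x))"
  shows "GDERIV (\<lambda>y. v (a *\<^sub>R y)) x :> a *\<^sub>R grad v (a *\<^sub>R x)"
proof -
  have "((\<lambda>y. a *\<^sub>R y) has_derivative (\<lambda>y. a *\<^sub>R y)) (at x)"
    by (auto intro!: derivative_eq_intros)
  from has_derivative_compose[OF this GDERIV_grad[OF assms, unfolded gderiv_def]]
  show ?thesis
    by (simp add: gderiv_def)
qed

text \<open>One factor \<open>a\<close> is already present in the gradient of the dilated function;
  differentiating the inner argument gives the second. The gradient formula holds only on the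
  preimage of \<open>U\<close>, and as that set is open it may be differentiated there.\<close>

lemma has_derivative_grad_dilation:
  fixes v :: "'a::euclidean_space \<Rightarrow> real"
  assumes "open U" "a *\<^sub>R x \<in> U" "C2_on U v"
  shows "(grad (\<lambda>y. v (a *\<^sub>R y)) has_derivative
    (\<lambda>h. a\<^sup>2 *\<^sub>R frechet_derivative (grad v) (at (a *\<^sub>R x)) h)) (at x)"
proof -
  define D where "D = frechet_derivative (grad v) (at (a *\<^sub>R x))"
  have D: "(grad v has_derivative D) (at (a *\<^sub>R x))"
    using assms frechet_derivative_works unfolding C2_on_def D_def by blast
  have "((\<lambda>y. a *\<^sub>R y) has_derivative (\<lambda>y. a *\<^sub>R y)) (at x)"
    by (auto intro!: derivative_eq_intros)
  from has_derivative_scaleR_right[OF has_derivative_compose[OF this D], of a]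
  have "((\<lambda>y. a *\<^sub>R grad v (a *\<^sub>R y)) has_derivative (\<lambda>h. a *\<^sub>R D (a *\<^sub>R h))) (at x)" .
  moreover have "D (a *\<^sub>R h) = a *\<^sub>R D h" for h
    using D has_derivative_linear linear_cmul by blast
  ultimately have "((\<lambda>y. a *\<^sub>R grad v (a *\<^sub>R y)) has_derivative (\<lambda>h. a\<^sup>2 *\<^sub>R D h)) (at x)"
    by (simp add: power2_eq_square)
  moreover have "open ((\<lambda>y. a *\<^sub>R y) -` U)"
    using \<open>open U\<close> by (intro open_vimage continuous_intros)
  moreover have "a *\<^sub>R grad v (a *\<^sub>R y) = grad (\<lambda>y. v (a *\<^sub>R y)) y"
    if "y \<in> (\<lambda>y. a *\<^sub>R y) -` U" for y
  proof -
    have "v differentiable (at (a *\<^sub>R y))"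
      using that \<open>C2_on U v\<close> unfolding C2_on_def by blast
    from grad_eqI[OF GDERIV_dilation[OF this]] show ?thesis ..
  qed
  ultimately show ?thesis
    using has_derivative_transform_within_open[of _ _ x UNIV "(\<lambda>y. a *\<^sub>R y) -` U"] \<open>a *\<^sub>R x \<in> U\<close>
    unfolding D_def by auto
qed

lemma frontier_scaleR:
  fixes U :: "'a::euclidean_space set"
  assumes "a \<noteq> 0"
  shows "frontier ((*\<^sub>R) a ` U) = (*\<^sub>R) a ` frontier U"
proof -
  have "interior ((*\<^sub>R) a ` U) = (*\<^sub>R) a ` interior U"
    using assms by (intro interior_injective_linear_image) (auto simp: inj_on_def linear_scale_self)
  then show ?thesis
    using assms unfolding frontier_def
    by (subst image_set_diff) (auto simp: inj_on_def closure_scaleR)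
qed

text \<open>The exponent 2 matters here: the squared gradient and the Laplacian both pick up the
  factor \<open>a\<^sup>2\<close>, so the equation keeps its form and only the constant
  changes.\<close>

lemma blowup_solution_dilation:
  fixes U :: "'a::euclidean_space set"
  assumes "open U" "r > 0" "blowup_solution \<epsilon> U c v"
  shows "blowup_solution \<epsilon> ((*\<^sub>R) r ` U) (c / r\<^sup>2) (\<lambda>x. v (x /\<^sub>R r))"
proof -
  define a where "a = inverse r"
  define w where "w = (\<lambda>x. v (a *\<^sub>R x))"
  let ?W = "(*\<^sub>R) r ` U"
  have a: "a > 0" "a *\<^sub>R (r *\<^sub>R x) = x" for x :: 'a
    using \<open>r > 0\<close> by (auto simp: a_def)
  have inU: "a *\<^sub>R x \<in> U" if "x \<in> ?W" for x
    using that a by auto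
  have v: "C2_on U v" "\<And>x. x \<in> U \<Longrightarrow> (norm (grad v x))\<^sup>2 - \<epsilon> * laplacian v x = c"
    "\<And>z. z \<in> frontier U \<Longrightarrow> filterlim v at_top (at z within U)"
    using assms(3) unfolding blowup_solution_def by auto
  have g: "GDERIV w x :> a *\<^sub>R grad v (a *\<^sub>R x)" if "x \<in> ?W" for x
    unfolding w_def using GDERIV_dilation v(1) inU[OF that] unfolding C2_on_def by blast
  have hess: "(grad w has_derivative
      (\<lambda>h. a\<^sup>2 *\<^sub>R frechet_derivative (grad v) (at (a *\<^sub>R x)) h)) (at x)" if "x \<in> ?W" for x
    unfolding w_def by (rule has_derivative_grad_dilation[OF \<open>open U\<close> inU[OF that] v(1)])
  note hess_eq = frechet_derivative_at[OF hess, symmetric]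
  have "continuous_on ?W (\<lambda>x. frechet_derivative (grad w) (at x) b)" if "b \<in> Basis" for b
  proof -
    have "continuous_on ?W (\<lambda>x. a\<^sup>2 *\<^sub>R frechet_derivative (grad v) (at (a *\<^sub>R x)) b)"
      using v(1) that inU unfolding C2_on_def
      by (intro continuous_on_scaleR continuous_on_const
          continuous_on_compose2[where f = "\<lambda>x. a *\<^sub>R x" and s = ?W and t = U
            and g = "\<lambda>x. frechet_derivative (grad v) (at x) b"] continuous_on_id) auto
    then show ?thesis
      by (rule continuous_on_eq) (simp add: hess_eq)
  qed
  moreover have "w differentiable (at x)" "grad w differentiable (at x)" if "x \<in> ?W" for x
    using g[OF that] hess[OF that] unfolding gderiv_def differentiable_def by blast+
  ultimately have "C2_on ?W w"
    unfolding C2_on_def by blast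
  moreover have "(norm (grad w x))\<^sup>2 - \<epsilon> * laplacian w x = c / r\<^sup>2" if "x \<in> ?W" for x
  proof -
    have "laplacian w x = a\<^sup>2 * laplacian v (a *\<^sub>R x)"
      by (simp add: laplacian_def hess_eq[OF that] sum_distrib_left)
    moreover have "(norm (grad w x))\<^sup>2 = a\<^sup>2 * (norm (grad v (a *\<^sub>R x)))\<^sup>2"
      by (simp add: grad_eqI[OF g[OF that]] power_mult_distrib)
    ultimately have "(norm (grad w x))\<^sup>2 - \<epsilon> * laplacian w x
        = a\<^sup>2 * ((norm (grad v (a *\<^sub>R x)))\<^sup>2 - \<epsilon> * laplacian v (a *\<^sub>R x))"
      by (simp add: algebra_simps)
    then show ?thesis
      unfolding v(2)[OF inU[OF that]] by (simp add: a_def power_inverse divide_inverse)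
  qed
  moreover have "filterlim w at_top (at z within ?W)" if "z \<in> frontier ?W" for z
  proof -
    have z: "a *\<^sub>R z \<in> frontier U"
      using that frontier_scaleR[of r U] \<open>r > 0\<close> a by auto
    \<comment> \<open>Both filters are punctured, so besides continuity one has to check that points
      other than \<open>z\<close> are not sent to the image of \<open>z\<close>; this holds because
      scaling by \<open>a > 0\<close> is injective.\<close>
    have "filterlim (\<lambda>x. a *\<^sub>R x) (at (a *\<^sub>R z) within U) (at z within ?W)"
      unfolding filterlim_at
    proof
      show "((\<lambda>x. a *\<^sub>R x) \<longlongrightarrow> a *\<^sub>R z) (at z within ?W)"
        by (intro tendsto_intros)
      show "\<forall>\<^sub>F x in at z within ?W. a *\<^sub>R x \<in> U \<and> a *\<^sub>R x \<noteq> a *\<^sub>R z"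
        using inU a by (auto simp: eventually_at_filter)
    qed
    from filterlim_compose[OF v(3)[OF z] this] show ?thesis
      by (simp add: w_def)
  qed
  ultimately show ?thesis
    unfolding blowup_solution_def w_def a_def by blast
qed

text \<open>An equivalence, so that the predicates under the description operator can be exchanged
  without knowing that solutions exist. The direction from the dilate back to \<open>U\<close> is a
  dilation by \<open>inverse r\<close>.\<close>

lemma blowup_solution_dilation_iff:
  fixes U :: "'a::euclidean_space set"
  assumes "open U" "r > 0"
  shows "(\<exists>v. blowup_solution \<epsilon> ((*\<^sub>R) r ` U) c v) \<longleftrightarrow> (\<exists>v. blowup_solution \<epsilon> U (c * r\<^sup>2) v)"
proof
  assume "\<exists>v. blowup_solution \<epsilon> U (c * r\<^sup>2) v"
  then show "\<exists>v. blowup_solution \<epsilon> ((*\<^sub>R) r ` U) c v"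
    using blowup_solution_dilation[OF assms, of \<epsilon> "c * r\<^sup>2"] \<open>r > 0\<close> by auto
next
  assume "\<exists>v. blowup_solution \<epsilon> ((*\<^sub>R) r ` U) c v"
  then obtain v where "blowup_solution \<epsilon> ((*\<^sub>R) r ` U) c v" ..
  moreover have "open ((*\<^sub>R) r ` U)"
    using assms by (intro open_scaling) auto
  ultimately have "blowup_solution \<epsilon> ((*\<^sub>R) (inverse r) ` (*\<^sub>R) r ` U) (c / (inverse r)\<^sup>2)
      (\<lambda>x. v (x /\<^sub>R inverse r))"
    using \<open>r > 0\<close> by (intro blowup_solution_dilation) auto
  moreover have "(*\<^sub>R) (inverse r) ` (*\<^sub>R) r ` U = U"
    using \<open>r > 0\<close> by (simp add: image_image)
  moreover have "c / (inverse r)\<^sup>2 = c * r\<^sup>2"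
    by (simp add: power_inverse divide_inverse)
  ultimately show "\<exists>v. blowup_solution \<epsilon> U (c * r\<^sup>2) v"
    by auto
qed

section \<open>Uniqueness of the constant\<close>

text \<open>The superlevel set \<open>K\<close> of \<open>u - v\<close> at the level of some point
  \<open>p\<close> is compact: \<open>u\<close> is bounded while \<open>v\<close> blows up, so
  \<open>K\<close> cannot accumulate at the frontier. A maximum over \<open>K\<close> is a maximum
  over \<open>U\<close>.\<close>

lemma attains_max_minus_blowup:
  fixes u v :: "'a::euclidean_space \<Rightarrow> real"
  assumes "open U" "bounded U" "U \<noteq> {}"
    and "continuous_on (closure U) u" "continuous_on U v"
    and blowup: "\<And>z. z \<in> frontier U \<Longrightarrow> filterlim v at_top (at z within U)"
  shows "\<exists>x\<in>U. \<forall>y\<in>U. u y - v y \<le> u x - v x"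
proof -
  obtain p where "p \<in> U"
    using \<open>U \<noteq> {}\<close> by blast
  have "bounded (u ` closure U)"
    using assms by (intro compact_imp_bounded compact_continuous_image) (auto simp: compact_closure)
  then obtain M where M: "\<And>x. x \<in> closure U \<Longrightarrow> u x \<le> M"
    unfolding bounded_iff by (metis abs_le_D1 imageI real_norm_def)
  define K where "K = {x \<in> U. u p - v p \<le> u x - v x}"
  have cont: "continuous_on U (\<lambda>x. u x - v x)"
    using continuous_on_subset[OF assms(4) closure_subset] assms(5) by (intro continuous_intros)
  have "closed K"
    unfolding closed_limpt
  proof (intro allI impI)
    fix z assume z: "z islimpt K"
    then have "z \<in> closure U"
      using islimpt_subset[of z K U] by (auto simp: K_def closure_def)
    have "z \<in> U"
    proof (rule ccontr)
      assume "z \<notin> U"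
      then have "z \<in> frontier U"
        using \<open>z \<in> closure U\<close> \<open>open U\<close> by (simp add: frontier_def interior_open)
      \<comment> \<open>Since \<open>u x \<le> M\<close>, any \<open>v x\<close> above this
        threshold makes \<open>u x - v x\<close> smaller than \<open>u p - v p\<close>, so
        \<open>x\<close> lies outside \<open>K\<close>.\<close>
      from blowup[OF this] have "\<forall>\<^sub>F x in at z within U. M - (u p - v p) < v x"
        by (simp add: filterlim_at_top_dense)
      then obtain d where d: "d > 0"
        "\<And>x. x \<in> U \<Longrightarrow> x \<noteq> z \<Longrightarrow> dist x z < d \<Longrightarrow> M - (u p - v p) < v x"
        unfolding eventually_at by blast
      obtain x where x: "x \<in> K" "x \<noteq> z" "dist x z < d"
        using z \<open>d > 0\<close> unfolding islimpt_approachable by blast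
      then have "x \<in> U" "u p - v p \<le> u x - v x"
        by (auto simp: K_def)
      with d(2)[of x] x M[of x] closure_subset[of U] show False
        by force
    qed
    \<comment> \<open>Now \<open>z\<close> is an interior point. On a small closed ball around it
      \<open>u - v\<close> is continuous, so the part of the superlevel set in that ball is closed
      and contains its limit point \<open>z\<close>.\<close>
    then obtain N where N: "N > 0" "cball z N \<subseteq> U"
      using \<open>open U\<close> open_contains_cball by blast
    have "closed {x \<in> cball z N. u p - v p \<le> u x - v x}"
      using continuous_on_closed_Collect_le[OF continuous_on_const continuous_on_subset[OF cont N(2)]
          closed_cball] .
    moreover have "z islimpt {x \<in> cball z N. u p - v p \<le> u x - v x}"
    proof -
      have "z islimpt (K \<inter> ball z N)"
      proof (rule islimptI)
        fix T assume "z \<in> T" "open T"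
        then have "z \<in> T \<inter> ball z N" "open (T \<inter> ball z N)"
          using \<open>N > 0\<close> by (simp_all add: open_Int)
        then obtain y where "y \<in> K" "y \<in> T \<inter> ball z N" "y \<noteq> z"
          by (rule islimptE[OF z])
        then show "\<exists>y\<in>K \<inter> ball z N. y \<in> T \<and> y \<noteq> z"
          by blast
      qed
      then show ?thesis
        by (rule islimpt_subset) (auto simp: K_def)
    qed
    ultimately have "z \<in> {x \<in> cball z N. u p - v p \<le> u x - v x}"
      unfolding closed_limpt by blast
    then show "z \<in> K"
      using \<open>z \<in> U\<close> by (simp add: K_def)
  qed
  moreover have "bounded K"
    using \<open>bounded U\<close> by (rule bounded_subset) (auto simp: K_def)
  moreover have "p \<in> K"
    using \<open>p \<in> U\<close> by (simp add: K_def)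
  moreover have "continuous_on K (\<lambda>x. u x - v x)"
    by (rule continuous_on_subset[OF cont]) (auto simp: K_def)
  ultimately obtain x where x: "x \<in> K" "\<And>y. y \<in> K \<Longrightarrow> u y - v y \<le> u x - v x"
    using continuous_attains_sup[of K "\<lambda>x. u x - v x"] compact_eq_bounded_closed[of K] by blast
  \<comment> \<open>Outside \<open>K\<close> the value is below that at \<open>p\<close>, which the
    value at \<open>x\<close> is not.\<close>
  have "u y - v y \<le> u x - v x" if "y \<in> U" for y
    using x(1) x(2)[of y] that by (cases "y \<in> K") (simp_all add: K_def)
  then show ?thesis
    using x(1) unfolding K_def by blast
qed

lemma C2_on_imp_continuous_on: "C2_on U v \<Longrightarrow> continuous_on U v"
  unfolding C2_on_def
  by (meson continuous_at_imp_continuous_on differentiable_imp_continuous_within)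

lemma C2_on_subset: "C2_on U v \<Longrightarrow> V \<subseteq> U \<Longrightarrow> C2_on V v"
  unfolding C2_on_def by (meson continuous_on_subset subsetD)

text \<open>On \<open>closure U\<close> the function \<open>u\<close> is finite and continuous, so
  \<open>u - v\<close> has a maximum in \<open>U\<close>. There the gradient terms cancel and
  \<open>a - b\<close> is \<epsilon> times the difference of the Laplacians of \<open>v\<close> and
  \<open>u\<close>, which is nonnegative.\<close>

lemma blowup_solution_const_le:
  fixes U V :: "'a::euclidean_space set"
  assumes "\<epsilon> > 0" "open U" "bounded U" "U \<noteq> {}" "closure U \<subseteq> V"
    and u: "blowup_solution \<epsilon> V a u" and v: "blowup_solution \<epsilon> U b v"
  shows "b \<le> a"
proof -
  have UV: "U \<subseteq> V"
    using assms(5) closure_subset by blast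
  have C2: "C2_on V u" "C2_on U v"
    using u v by (auto simp: blowup_solution_def)
  have "\<exists>x\<in>U. \<forall>y\<in>U. u y - v y \<le> u x - v x"
  proof (rule attains_max_minus_blowup)
    show "continuous_on (closure U) u"
      using C2_on_imp_continuous_on[OF C2(1)] assms(5) continuous_on_subset by blast
    show "continuous_on U v"
      using C2_on_imp_continuous_on[OF C2(2)] .
    show "filterlim v at_top (at z within U)" if "z \<in> frontier U" for z
      using v that by (simp add: blowup_solution_def)
  qed (use assms in auto)
  then obtain x where x: "x \<in> U" "\<And>y. y \<in> U \<Longrightarrow> u y - v y \<le> u x - v x"
    by blast
  note max = grad_and_laplacian_at_max[OF \<open>open U\<close> x(1) C2_on_subset[OF C2(1) UV] C2(2) x(2)]
  have "a = (norm (grad u x))\<^sup>2 - \<epsilon> * laplacian u x" "b = (norm (grad v x))\<^sup>2 - \<epsilon> * laplacian v x"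
    using u v x(1) UV by (auto simp: blowup_solution_def)
  moreover have "\<epsilon> * laplacian u x \<le> \<epsilon> * laplacian v x"
    using max(2) \<open>\<epsilon> > 0\<close> by simp
  ultimately show ?thesis
    using max(1) by simp
qed

lemma blowup_solution_const_unique:
  fixes U :: "'a::euclidean_space set"
  assumes "\<epsilon> > 0" "open U" "bounded U" "U \<noteq> {}"
    and dil: "\<And>s. s > 0 \<Longrightarrow> closure U \<subseteq> (*\<^sub>R) (1 + s) ` U"
    and "blowup_solution \<epsilon> U a u" "blowup_solution \<epsilon> U b v"
  shows "a = b"
proof -
  \<comment> \<open>Stated for arbitrary solutions, so that it can be applied in both orders. Only
    the first solution is dilated.\<close>
  have le: "b \<le> a" if "blowup_solution \<epsilon> U a u" "blowup_solution \<epsilon> U b v" for a b u v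
  proof -
    have "b \<le> a / (1 + s)\<^sup>2" if "s > 0" for s
    proof (rule blowup_solution_const_le[OF assms(1-4) dil[OF that]])
      show "blowup_solution \<epsilon> ((*\<^sub>R) (1 + s) ` U) (a / (1 + s)\<^sup>2) (\<lambda>x. u (x /\<^sub>R (1 + s)))"
        using that \<open>blowup_solution \<epsilon> U a u\<close> assms(2) by (intro blowup_solution_dilation) auto
    qed fact
    then have "\<forall>\<^sub>F s in at_right 0. b \<le> a / (1 + s)\<^sup>2"
      by (auto simp: eventually_at_filter)
    moreover have "((\<lambda>s. a / (1 + s)\<^sup>2) \<longlongrightarrow> a / (1 + 0)\<^sup>2) (at_right 0)"
      by (intro tendsto_intros) auto
    ultimately show "b \<le> a"
      using tendsto_lowerbound by fastforce
  qed
  show ?thesis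
    using le[OF assms(6,7)] le[OF assms(7,6)] by simp
qed

text \<open>Star-shapedness places \<open>y /\<^sub>R (1 + s)\<close> in \<open>closure U\<close>.
  Were it on the frontier, the distance hypothesis would keep \<open>y\<close> at distance at least
  \<open>k * s > 0\<close> from \<open>closure U\<close>, which contains \<open>y\<close>. So it is
  an interior point.\<close>

lemma closure_subset_dilation:
  fixes U :: "'a::euclidean_space set"
  assumes star: "\<forall>x\<in>U. closed_segment 0 x \<subseteq> U"
    and "k > 0" and dist: "\<forall>s>0. \<forall>x\<in>(*\<^sub>R) (1 + s) ` frontier U. infdist x (closure U) \<ge> k * s"
    and "s > 0"
  shows "closure U \<subseteq> (*\<^sub>R) (1 + s) ` U"
proof
  fix y assume y: "y \<in> closure U"
  define x where "x = y /\<^sub>R (1 + s)"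
  have y_eq: "y = (1 + s) *\<^sub>R x"
    using \<open>s > 0\<close> by (simp add: x_def)
  have "(*\<^sub>R) (inverse (1 + s)) ` U \<subseteq> U"
  proof
    fix z assume "z \<in> (*\<^sub>R) (inverse (1 + s)) ` U"
    then obtain w where w: "w \<in> U" "z = inverse (1 + s) *\<^sub>R w"
      by blast
    have "0 \<le> inverse (1 + s)" "inverse (1 + s) \<le> 1"
      using \<open>s > 0\<close> by (auto simp: field_simps)
    then have "z \<in> closed_segment 0 w"
      unfolding closed_segment_def w(2) by auto
    then show "z \<in> U"
      using star w(1) by blast
  qed
  then have "x \<in> closure U"
    using y closure_mono closure_scaleR[of "inverse (1 + s)" U] unfolding x_def by blast
  moreover have "x \<notin> frontier U"
  proof
    assume "x \<in> frontier U"
    then have "infdist y (closure U) \<ge> k * s"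
      using dist \<open>s > 0\<close> y_eq by blast
    then show False
      using y mult_pos_pos[OF \<open>k > 0\<close> \<open>s > 0\<close>] by simp
  qed
  ultimately have "x \<in> U"
    using interior_subset by (auto simp: frontier_def)
  then show "y \<in> (*\<^sub>R) (1 + s) ` U"
    using y_eq by blast
qed

section \<open>The eigenvalue as a function of the dilation parameter\<close>

theorem corollary6p1:
  fixes \<epsilon> \<epsilon>\<^sub>0 \<kappa> :: real
    and \<Omega> :: "(real ^ 'n) set"
    and c :: "real \<Rightarrow> real"
  assumes "\<epsilon> > 0"
    and "0 < \<epsilon>\<^sub>0" "\<epsilon>\<^sub>0 < 1"
    and "open \<Omega>" "bounded \<Omega>" "connected \<Omega>" "C2_boundary \<Omega>"
    and "\<forall>x\<in>\<Omega>. closed_segment 0 x \<subseteq> \<Omega>"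
    and "\<kappa> > 0" "cball 0 \<kappa> \<subseteq> \<Omega>"
    and "\<forall>s>0. \<forall>x\<in>(*\<^sub>R) (1 + s) ` frontier \<Omega>. infdist x (closure \<Omega>) \<ge> \<kappa> * s"
  defines "c \<equiv> \<lambda>l. additive_eigenvalue \<epsilon> ((*\<^sub>R) (1 + l) ` \<Omega>)"
  shows "\<forall>l\<in>{-\<epsilon>\<^sub>0<..<\<epsilon>\<^sub>0}. c differentiable (at l) \<and> deriv c differentiable (at l)"
proof -
  have unique: "a = b" if "blowup_solution \<epsilon> \<Omega> a u" "blowup_solution \<epsilon> \<Omega> b v" for a b u v
  proof (rule blowup_solution_const_unique[OF \<open>\<epsilon> > 0\<close> \<open>open \<Omega>\<close> \<open>bounded \<Omega>\<close> _ _ that])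
    show "\<Omega> \<noteq> {}"
      using \<open>\<kappa> > 0\<close> \<open>cball 0 \<kappa> \<subseteq> \<Omega>\<close> by auto
    show "closure \<Omega> \<subseteq> (*\<^sub>R) (1 + s) ` \<Omega>" if "s > 0" for s
      using closure_subset_dilation assms that by blast
  qed
  \<comment> \<open>All eigenvalues are expressed through the one fixed domain \<Omega>.\<close>
  have c_eq: "c l = (THE d. \<exists>v. blowup_solution \<epsilon> \<Omega> (d * (1 + l)\<^sup>2) v)" if "l > -1" for l
    using that blowup_solution_dilation_iff[OF \<open>open \<Omega>\<close>, of "1 + l"]
    by (simp add: c_def additive_eigenvalue_def)
  \<comment> \<open>The constant \<open>B\<close> lets one formula cover both cases: it is 0 if a
    solution exists, and otherwise it is the unspecified value \<open>THE d. False\<close>, the same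
    for every \<open>l\<close>.\<close>
  have "\<exists>A B. \<forall>l>-1. c l = A * inverse (1 + l) ^ 2 + B"
  proof (cases "\<exists>d v. blowup_solution \<epsilon> \<Omega> d v")
    case True
    then obtain d v where d: "blowup_solution \<epsilon> \<Omega> d v"
      by blast
    have "c l = d * inverse (1 + l) ^ 2 + 0" if "l > -1" for l
      unfolding c_eq[OF that]
    proof (rule the_equality)
      show "\<exists>v. blowup_solution \<epsilon> \<Omega> ((d * inverse (1 + l) ^ 2 + 0) * (1 + l)\<^sup>2) v"
        using d that by (auto simp: field_simps)
      fix d' assume "\<exists>v. blowup_solution \<epsilon> \<Omega> (d' * (1 + l)\<^sup>2) v"
      then have "d = d' * (1 + l)\<^sup>2"
        using unique[OF d] by blast
      then show "d' = d * inverse (1 + l) ^ 2 + 0"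
        using that by (simp add: power_inverse)
    qed
    then show ?thesis
      by blast
  next
    case False
    then have "c l = 0 * inverse (1 + l) ^ 2 + (THE d. False)" if "l > -1" for l
      using c_eq[OF that] by simp
    then show ?thesis
      by blast
  qed
  then obtain A B where AB: "\<And>l. l > -1 \<Longrightarrow> A * inverse (1 + l) ^ 2 + B = c l"
    by metis
  have der: "DERIV c l :> -2 * A * inverse (1 + l) ^ 3" if "l > -1" for l
  proof -
    have "DERIV (\<lambda>l. A * inverse (1 + l) ^ 2 + B) l :> -2 * A * inverse (1 + l) ^ 3"
      using that by (auto intro!: derivative_eq_intros simp: power2_eq_square power3_eq_cube)
    then show ?thesis
      using has_field_derivative_transform_within_open[of _ _ l "{-1<..}" c] that AB by simp
  qed
  \<comment> \<open>The formula for \<open>deriv c\<close> is known on the whole open half-line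
    above -1, hence in a neighbourhood of \<open>l\<close>, so it can be differentiated once
    more.\<close>
  have der2: "DERIV (deriv c) l :> 6 * A * inverse (1 + l) ^ 4" if "l > -1" for l
  proof -
    have "DERIV (\<lambda>l. -2 * A * inverse (1 + l) ^ 3) l :> 6 * A * inverse (1 + l) ^ 4"
      using that by (auto intro!: derivative_eq_intros simp: power2_eq_square power_numeral_reduce)
    then show ?thesis
      using has_field_derivative_transform_within_open[of _ _ l "{-1<..}" "deriv c"] that
        DERIV_imp_deriv[OF der] by simp
  qed
  show ?thesis
  proof
    fix l assume "l \<in> {-\<epsilon>\<^sub>0<..<\<epsilon>\<^sub>0}"
    then have "l > -1"
      using \<open>\<epsilon>\<^sub>0 < 1\<close> by simp
    then show "c differentiable (at l) \<and> deriv c differentiable (at l)"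
      using der der2 real_differentiable_def by blast
  qed
qed

end
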